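(* Let $m\in\mathbb{Z}_{>0}$. Then there exists $C>0$ such that $$\sum_{|\alpha|=m}\left\|[x^\alpha,e^{t\nu\Delta}]\varphi\right\|_1\le C\left\{t^{\frac12}\left\||x|^{m-1}\varphi\right\|_1+\left(t^{\frac12}+t^{\frac m2}\right)\|\varphi\|_1\right\}$$ holds for any $\varphi\in L^1_m(\mathbb{R}^n)$ and $t>0$.
   Context: Let $n\in\mathbb{Z}_{>0}$ and $\nu\in\mathbb{C}$ with $\operatorname{Re}\nu>0$. $G_{t\nu}(x)=(4\pi t\nu)^{-n/2}\exp\left(-\frac{|x|^2}{4t\nu}\right)$ (principal branch of the power), and $e^{t\nu\Delta}\varphi=G_{t\nu}*\varphi$ for $t>0$. For $\alpha\in\mathbb{Z}_{\ge0}^n$, $|\alpha|=\sum_j\alpha_j$ and $x^\alpha=\prod_jx_j^{\alpha_j}$. The commutator is $[x^\alpha,e^{t\nu\Delta}]\varphi:=x^\alpha e^{t\nu\Delta}\varphi-e^{t\nu\Delta}x^\alpha\varphi$, where $e^{t\nu\Delta}x^\alpha\varphi$ means $e^{t\nu\Delta}$ applied to the function $x\mapsto x^\alpha\varphi(x)$. For $m\in\mathbb{Z}_{>0}$, $L^1_m(\mathbb{R}^n)$ is the set of complex-valued $\varphi\in L^1(\mathbb{R}^n)$ with $x^\alpha\varphi\in L^1(\mathbb{R}^n)$ for all $|\alpha|\le m$. $\|\cdot\|_1$ is the $L^1(\mathbb{R}^n)$ norm. *)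

theory Defs
  imports "HOL-Analysis.Analysis"
begin

definition mi_order :: "('n::finite \<Rightarrow> nat) \<Rightarrow> nat" where
  "mi_order \<alpha> = (\<Sum>j\<in>UNIV. \<alpha> j)"

definition mi_power :: "real ^ 'n \<Rightarrow> ('n::finite \<Rightarrow> nat) \<Rightarrow> real" where
  "mi_power x \<alpha> = (\<Prod>j\<in>UNIV. (x $ j) ^ \<alpha> j)"

definition mi_mult :: "('n::finite \<Rightarrow> nat) \<Rightarrow> (real ^ 'n \<Rightarrow> complex) \<Rightarrow> real ^ 'n \<Rightarrow> complex" where
  "mi_mult \<alpha> \<phi> = (\<lambda>x. complex_of_real (mi_power x \<alpha>) * \<phi> x)"

text \<open>The norm takes values in \<open>ennreal\<close>, so that a function that is not integrable does not
  get the default value \<open>0\<close> of the Bochner integral.\<close>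

definition L1_norm :: "(real ^ 'n::finite \<Rightarrow> complex) \<Rightarrow> ennreal" where
  "L1_norm f = (\<integral>\<^sup>+ x. ennreal (norm (f x)) \<partial>lebesgue)"

definition weighted_L1 :: "nat \<Rightarrow> (real ^ 'n::finite \<Rightarrow> complex) set" where
  "weighted_L1 m = {\<phi>. integrable lebesgue \<phi> \<and>
     (\<forall>\<alpha>. mi_order \<alpha> \<le> m \<longrightarrow> integrable lebesgue (mi_mult \<alpha> \<phi>))}"

definition convol ::
    "(real ^ 'n::finite \<Rightarrow> complex) \<Rightarrow> (real ^ 'n \<Rightarrow> complex) \<Rightarrow> real ^ 'n \<Rightarrow> complex" where
  "convol f g = (\<lambda>x. \<integral>y. f (x - y) * g y \<partial>lebesgue)"

text \<open>The parameter \<open>z\<close> stands for the product \<open>t\<nu>\<close>. Complex \<open>powr\<close> is the principal branch.\<close>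

definition gauss_kernel :: "complex \<Rightarrow> real ^ 'n::finite \<Rightarrow> complex" where
  "gauss_kernel z = (\<lambda>x. (4 * complex_of_real pi * z) powr (- (of_nat CARD('n) / 2)) *
     exp (- (complex_of_real ((norm x)\<^sup>2) / (4 * z))))"

definition heat_op :: "complex \<Rightarrow> (real ^ 'n::finite \<Rightarrow> complex) \<Rightarrow> real ^ 'n \<Rightarrow> complex" where
  "heat_op z \<phi> = convol (gauss_kernel z) \<phi>"

definition heat_commutator ::
    "('n::finite \<Rightarrow> nat) \<Rightarrow> complex \<Rightarrow> (real ^ 'n \<Rightarrow> complex) \<Rightarrow> real ^ 'n \<Rightarrow> complex" where
  "heat_commutator \<alpha> z \<phi> = (\<lambda>x. mi_mult \<alpha> (heat_op z \<phi>) x - heat_op z (mi_mult \<alpha> \<phi>) x)"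

end

theory Submission
  imports Defs "HOL-Probability.Distributions"
begin

text \<open>
  The commutator is the integral operator with kernel \<open>G(x - y) (x\<^sup>\<alpha> - y\<^sup>\<alpha>)\<close>, where \<open>G\<close> is the
  Gaussian of parameter \<open>t\<nu>\<close>. With \<open>w = x - y\<close>, the difference of the monomials is bounded by a
  multiple of \<open>|w| |y|\<^sup>m\<^sup>-\<^sup>1 + |w|\<^sup>m\<close>, and each factor \<open>|w|\<close> costs \<open>t\<^sup>1\<^sup>/\<^sup>2\<close> when it is absorbed into
  \<open>|G(w)|\<close>: pointwise, \<open>|G(w)| |w|\<^sup>k\<close> is at most a multiple of \<open>t\<^sup>k\<^sup>/\<^sup>2\<close> times the density of a
  normal distribution with twice the variance. Tonelli's theorem then gives the \<open>L\<^sup>1\<close> bound.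
\<close>

section \<open>Differences of monomials\<close>

text \<open>Product rule for differences: \<open>a * A - b * B = a * (A - B) + (a - b) * B\<close>.
  The constants \<open>k\<close> and \<open>l\<close> add up just as degrees do. The factor
  \<open>R\<close> on the left replaces a division by \<open>R\<close>: the bounds then carry full
  powers of \<open>R\<close>, with no truncated exponent and no exception in degree 0.\<close>

lemma abs_mult_diff_le:
  fixes a b A B R d k l r S :: real
  assumes "\<bar>a\<bar> \<le> r" "\<bar>B\<bar> \<le> S" "R * \<bar>a - b\<bar> \<le> k * d * r" "R * \<bar>A - B\<bar> \<le> l * d * S"
    and "0 \<le> R"
  shows "R * \<bar>a * A - b * B\<bar> \<le> (k + l) * d * (r * S)"
proof -
  have "a * A - b * B = a * (A - B) + (a - b) * B"
    by (simp add: algebra_simps)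
  then have "\<bar>a * A - b * B\<bar> \<le> \<bar>a\<bar> * \<bar>A - B\<bar> + \<bar>a - b\<bar> * \<bar>B\<bar>"
    by (metis abs_mult abs_triangle_ineq)
  then have "R * \<bar>a * A - b * B\<bar> \<le> R * (\<bar>a\<bar> * \<bar>A - B\<bar> + \<bar>a - b\<bar> * \<bar>B\<bar>)"
    using \<open>0 \<le> R\<close> by (rule mult_left_mono)
  also have "\<dots> = \<bar>a\<bar> * (R * \<bar>A - B\<bar>) + (R * \<bar>a - b\<bar>) * \<bar>B\<bar>"
    by (simp add: algebra_simps)
  also have "\<dots> \<le> r * (l * d * S) + (k * d * r) * S"
  proof (rule add_mono)
    show "\<bar>a\<bar> * (R * \<bar>A - B\<bar>) \<le> r * (l * d * S)"
      using \<open>0 \<le> R\<close> assms(1) by (intro mult_mono[OF assms(1,4)]) auto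
    have "0 \<le> k * d * r"
      using assms(3,5) by (meson abs_ge_zero mult_nonneg_nonneg order_trans)
    then show "(R * \<bar>a - b\<bar>) * \<bar>B\<bar> \<le> (k * d * r) * S"
      by (intro mult_mono[OF assms(3,2)]) auto
  qed
  finally show ?thesis
    by (simp add: algebra_simps)
qed

text \<open>This is the mean value estimate with constant \<open>k * R ^ (k - 1)\<close>, multiplied
  through by \<open>R\<close>. The induction splits off one factor \<open>a\<close> and applies the
  product rule.\<close>

lemma abs_power_diff_le:
  fixes a b R d :: real
  assumes "\<bar>a\<bar> \<le> R" "\<bar>b\<bar> \<le> R" "\<bar>a - b\<bar> \<le> d"
  shows "R * \<bar>a ^ k - b ^ k\<bar> \<le> real k * d * R ^ k"
proof (induction k)
  case (Suc k)
  have "0 \<le> R"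
    using assms by linarith
  have "R * \<bar>a - b\<bar> \<le> 1 * d * R"
    using mult_left_mono[OF assms(3) \<open>0 \<le> R\<close>] by (simp add: mult.commute)
  moreover have "\<bar>b ^ k\<bar> \<le> R ^ k"
    using assms by (simp add: power_abs power_mono)
  ultimately show ?case
    using abs_mult_diff_le[OF assms(1), of "b ^ k" "R ^ k" R b 1 d "a ^ k" "real k"] Suc \<open>0 \<le> R\<close>
    by (simp add: add.commute)
qed simp

text \<open>Induction over the variables: the product rule combines the power of the new variable
  with the remaining monomial, and the degrees add up to the total degree.\<close>

lemma abs_prod_power_diff_le:
  fixes a b :: "'i \<Rightarrow> real"
  assumes "finite I" "\<And>i. \<bar>a i\<bar> \<le> R" "\<And>i. \<bar>b i\<bar> \<le> R" "\<And>i. \<bar>a i - b i\<bar> \<le> d"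
  shows "R * \<bar>(\<Prod>i\<in>I. a i ^ \<alpha> i) - (\<Prod>i\<in>I. b i ^ \<alpha> i)\<bar> \<le> real (\<Sum>i\<in>I. \<alpha> i) * d * R ^ (\<Sum>i\<in>I. \<alpha> i)"
  using \<open>finite I\<close>
proof (induction I rule: finite_induct)
  case (insert i I)
  have "0 \<le> R"
    \<comment> \<open>The bounds hold at every index of the type, so an arbitrary one shows that
      \<open>R\<close> is nonnegative, even when \<open>I\<close> is empty.\<close>
    using assms(2)[of undefined] by linarith
  have "\<bar>a i ^ \<alpha> i\<bar> \<le> R ^ \<alpha> i"
    using assms by (simp add: power_abs power_mono)
  moreover have "\<bar>\<Prod>i\<in>I. b i ^ \<alpha> i\<bar> \<le> R ^ (\<Sum>i\<in>I. \<alpha> i)"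
    unfolding abs_prod power_sum using assms
    by (intro prod_mono) (simp add: power_abs power_mono)
  ultimately show ?case
    using abs_mult_diff_le[OF _ _ abs_power_diff_le[OF assms(2-4)] insert.IH \<open>0 \<le> R\<close>] insert.hyps
    by (simp add: power_add)
qed simp

text \<open>All components of \<open>x\<close> and \<open>y\<close> are bounded by
  \<open>R = norm y + norm (x - y)\<close>, so the mean value estimate applies; then
  \<open>R ^ (m - 1)\<close> is split. The bound uses only \<open>y\<close>, where the initial
  function is evaluated, and \<open>x - y\<close>, where the kernel is evaluated.\<close>

lemma abs_mi_power_diff_le:
  fixes x y :: "real ^ 'n::finite"
  assumes "mi_order \<alpha> = m" "m > 0"
  shows "\<bar>mi_power x \<alpha> - mi_power y \<alpha>\<bar> \<le>
    real m * 2 ^ (m - 1) * (norm (x - y) * norm y ^ (m - 1) + norm (x - y) ^ m)"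
proof -
  define w where "w = x - y"
  define R where "R = norm y + norm w"
  have x: "x = y + w"
    by (simp add: w_def)
  have "\<bar>x $ i\<bar> \<le> R" for i
    using component_le_norm_cart[of x i] norm_triangle_ineq[of y w] by (simp add: x R_def)
  moreover have "\<bar>y $ i\<bar> \<le> R" for i
    using component_le_norm_cart[of y i] by (simp add: R_def add_increasing2)
  moreover have "\<bar>x $ i - y $ i\<bar> \<le> norm w" for i
    using component_le_norm_cart[of w i] by (simp add: x)
  ultimately have le: "R * \<bar>mi_power x \<alpha> - mi_power y \<alpha>\<bar> \<le> real m * norm w * R ^ m"
    unfolding mi_power_def assms(1)[symmetric] mi_order_def
    by (intro abs_prod_power_diff_le) auto
  have diff: "\<bar>mi_power x \<alpha> - mi_power y \<alpha>\<bar> \<le> real m * norm w * R ^ (m - 1)"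
  \<comment> \<open>The factor \<open>R\<close> is now divided out. If \<open>R = 0\<close>, then
    \<open>x = y\<close> and the difference vanishes.\<close>
  proof (cases "R = 0")
    case True
    then have "w = 0"
      using norm_ge_zero[of y] norm_ge_zero[of w] unfolding R_def
      by (metis add_nonneg_eq_0_iff norm_eq_zero)
    then show ?thesis
      by (simp add: x)
  next
    case False
    then have "R > 0"
      by (simp add: R_def less_le)
    have "R ^ m = R * R ^ (m - 1)"
      using \<open>m > 0\<close> by (simp add: power_eq_if)
    with le have "R * \<bar>mi_power x \<alpha> - mi_power y \<alpha>\<bar> \<le> R * (real m * norm w * R ^ (m - 1))"
      by (simp add: ac_simps)
    with \<open>R > 0\<close> show ?thesis
      using mult_le_cancel_left_pos by blast
  qed
  \<comment> \<open>A sum is at most twice the maximum, and a power of the maximum is one of the two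
    powers, hence at most their sum.\<close>
  have "R ^ (m - 1) \<le> (2 * max (norm y) (norm w)) ^ (m - 1)"
    by (intro power_mono) (auto simp: R_def)
  also have "\<dots> \<le> 2 ^ (m - 1) * (norm y ^ (m - 1) + norm w ^ (m - 1))"
    unfolding power_mult_distrib by (intro mult_left_mono) (auto simp: max_def)
  finally have "real m * norm w * R ^ (m - 1) \<le>
      real m * norm w * (2 ^ (m - 1) * (norm y ^ (m - 1) + norm w ^ (m - 1)))"
    by (intro mult_left_mono) auto
  also have "\<dots> = real m * 2 ^ (m - 1) * (norm w * norm y ^ (m - 1) + norm w * norm w ^ (m - 1))"
    by (simp add: algebra_simps)
  also have "norm w * norm w ^ (m - 1) = norm w ^ m"
    using \<open>m > 0\<close> by (simp add: power_eq_if)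
  finally show ?thesis
    using diff by (simp add: w_def)
qed

section \<open>Real Gaussian densities and the modulus of the heat kernel\<close>

text \<open>The centred normal density with covariance \<open>\<sigma>\<^sup>2\<close> times the
  identity. The product form reduces its total mass to dimension one; the radial form is
  \<open>gauss_density_eq\<close>.\<close>

definition gauss_density :: "real \<Rightarrow> 'a::euclidean_space \<Rightarrow> real" where
  "gauss_density \<sigma> x = (\<Prod>b\<in>Basis. normal_density 0 \<sigma> (x \<bullet> b))"

lemma gauss_density_nonneg: "0 \<le> gauss_density \<sigma> x"
  by (simp add: gauss_density_def prod_nonneg)

lemma borel_measurable_gauss_density [measurable]: "gauss_density \<sigma> \<in> borel_measurable borel"
  unfolding gauss_density_def by measurable

lemma nn_integral_gauss_density:
  assumes "\<sigma> > 0"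
  shows "(\<integral>\<^sup>+ x. ennreal (gauss_density \<sigma> x) \<partial>(lborel :: 'a::euclidean_space measure)) = 1"
proof -
  have "(\<integral>\<^sup>+ x. ennreal (gauss_density \<sigma> x) \<partial>(lborel :: 'a measure))
      = (\<integral>\<^sup>+ x. (\<Prod>b\<in>Basis. ennreal (normal_density 0 \<sigma> (x \<bullet> b))) \<partial>(lborel :: 'a measure))"
    by (simp add: gauss_density_def prod_ennreal)
  also have "\<dots> = (\<Prod>b\<in>(Basis :: 'a set). \<integral>\<^sup>+ x. ennreal (normal_density 0 \<sigma> x) \<partial>lborel)"
    by (subst nn_integral_lborel_prod) auto
  also have "(\<integral>\<^sup>+ x. ennreal (normal_density 0 \<sigma> x) \<partial>lborel) = 1"
    using assms by (subst nn_integral_eq_integral) auto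
  finally show ?thesis
    by simp
qed

lemma gauss_density_eq:
  fixes x :: "'a::euclidean_space"
  shows "gauss_density \<sigma> x =
    exp (- (norm x)\<^sup>2 / (2 * \<sigma>\<^sup>2)) / sqrt (2 * pi * \<sigma>\<^sup>2) ^ DIM('a)"
proof -
  have "(norm x)\<^sup>2 = (\<Sum>b\<in>Basis. (x \<bullet> b)\<^sup>2)"
    unfolding power2_norm_eq_inner by (subst euclidean_inner) (simp add: power2_eq_square)
  then have "exp (- (norm x)\<^sup>2 / (2 * \<sigma>\<^sup>2)) = (\<Prod>b\<in>Basis. exp (- (x \<bullet> b)\<^sup>2 / (2 * \<sigma>\<^sup>2)))"
    by (simp add: exp_sum[symmetric] sum_negf sum_divide_distrib)
  then show ?thesis
    by (simp add: gauss_density_def normal_density_def prod_dividef)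
qed

text \<open>The decay rate comes from
  \<open>Re (1 / \<nu>) = Re \<nu> / (norm \<nu>)\<^sup>2\<close>. The exponent of the prefactor is
  real, so the modulus of the power depends only on the modulus of its base.\<close>

lemma norm_gauss_kernel:
  fixes x :: "real ^ 'n::finite"
  assumes "t > 0" "Re \<nu> > 0"
  shows "norm (gauss_kernel (complex_of_real t * \<nu>) x) =
    exp (- (Re \<nu> / (4 * (norm \<nu>)\<^sup>2)) * (norm x)\<^sup>2 / t) / sqrt (4 * pi * t * norm \<nu>) ^ CARD('n)"
proof -
  let ?z = "complex_of_real t * \<nu>"
  have "\<nu> \<noteq> 0"
    using assms by auto
  have "Re (complex_of_real ((norm x)\<^sup>2) / (4 * ?z)) = (Re \<nu> / (4 * (norm \<nu>)\<^sup>2)) * (norm x)\<^sup>2 / t"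
    using \<open>\<nu> \<noteq> 0\<close> \<open>t > 0\<close>
    by (subst complex_div_cnj) (simp add: norm_mult field_simps power2_eq_square)
  moreover have "norm ((4 * complex_of_real pi * ?z) powr (- (of_nat CARD('n) / 2)))
      = norm (4 * complex_of_real pi * ?z) powr (- (real CARD('n) / 2))"
    by (subst norm_powr_real_powr') auto
  moreover have "norm (4 * complex_of_real pi * ?z) = 4 * pi * t * norm \<nu>"
    using assms by (simp add: norm_mult)
  moreover have "(4 * pi * t * norm \<nu>) powr (- (real CARD('n) / 2)) = 1 / sqrt (4 * pi * t * norm \<nu>) ^ CARD('n)"
  proof -
    have "4 * pi * t * norm \<nu> > 0"
      using assms \<open>\<nu> \<noteq> 0\<close> by simp
    then show ?thesis
      by (simp add: powr_minus_divide powr_half_sqrt_powr powr_realpow real_sqrt_power)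
  qed
  ultimately show ?thesis
    using \<open>t > 0\<close> unfolding gauss_kernel_def norm_mult by (simp add: mult.assoc)
qed

text \<open>Half of the Gaussian decay pays for the polynomial: \<open>s ^ k\<close> is at most
  \<open>exp (k * \<bar>s\<bar>)\<close>, and completing the square absorbs this linear exponent at
  the cost of a constant.\<close>

lemma power_mult_gauss_le:
  fixes s c :: real
  assumes "c > 0"
  shows "s ^ k * exp (- 2 * c * s\<^sup>2) \<le> exp ((real k)\<^sup>2 / (4 * c)) * exp (- c * s\<^sup>2)"
proof -
  have "s ^ k \<le> \<bar>s\<bar> ^ k"
    by (simp add: power_abs[symmetric])
  also have "\<bar>s\<bar> ^ k \<le> exp \<bar>s\<bar> ^ k"
    using exp_ge_add_one_self[of "\<bar>s\<bar>"] by (intro power_mono) linarith+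
  also have "\<dots> = exp (real k * \<bar>s\<bar>)"
    by (simp add: exp_of_nat_mult)
  finally have "s ^ k * exp (- 2 * c * s\<^sup>2) \<le> exp (real k * \<bar>s\<bar>) * exp (- 2 * c * s\<^sup>2)"
    by (intro mult_right_mono) auto
  also have "\<dots> = exp (real k * \<bar>s\<bar> - 2 * c * s\<^sup>2)"
    by (simp add: exp_add[symmetric])
  also have "real k * \<bar>s\<bar> - 2 * c * s\<^sup>2 \<le> (real k)\<^sup>2 / (4 * c) - c * s\<^sup>2"
  proof -
    have "0 \<le> (real k - 2 * c * \<bar>s\<bar>)\<^sup>2 / (4 * c)"
      using assms by simp
    also have "\<dots> = (real k)\<^sup>2 / (4 * c) - real k * \<bar>s\<bar> + c * s\<^sup>2"
      using assms by (simp add: power2_diff field_simps power2_eq_square)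
    finally show ?thesis by simp
  qed
  then have "exp (real k * \<bar>s\<bar> - 2 * c * s\<^sup>2) \<le> exp ((real k)\<^sup>2 / (4 * c) - c * s\<^sup>2)"
    by simp
  also have "\<dots> = exp ((real k)\<^sup>2 / (4 * c)) * exp (- c * s\<^sup>2)"
    by (simp add: exp_add[symmetric])
  finally show ?thesis .
qed

text \<open>In the scaled variable \<open>s = norm x / sqrt t\<close> the exponent of the kernel is
  free of \<open>t\<close>, so \<open>norm x ^ k\<close> contributes exactly
  \<open>t powr (k / 2)\<close> and \<open>D\<close> is uniform in \<open>t\<close> and
  \<open>x\<close>. The variance on the right is twice that of the Gaussian
  \<open>norm (gauss_kernel ...)\<close>, because half of the decay is given up.\<close>

lemma gauss_kernel_moment_le:
  fixes \<nu> :: complex and k :: nat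
  assumes "Re \<nu> > 0"
  obtains D where "D > 0"
    "\<And>t x. t > 0 \<Longrightarrow> norm (gauss_kernel (complex_of_real t * \<nu>) (x :: real ^ 'n::finite)) * norm x ^ k
       \<le> D * t powr (real k / 2) * gauss_density (sqrt (4 * t * (norm \<nu>)\<^sup>2 / Re \<nu>)) x"
proof -
  \<comment> \<open>The modulus of the kernel decays like \<open>exp (- 2 * c * s\<^sup>2)\<close>,
    so \<open>c\<close> is half of its rate.\<close>
  define c where "c = Re \<nu> / (8 * (norm \<nu>)\<^sup>2)"
  have "\<nu> \<noteq> 0"
    using assms by auto
  have "c > 0"
    using assms \<open>\<nu> \<noteq> 0\<close> by (simp add: c_def)
  \<comment> \<open>The first factor is the cost of completing the square, the second the ratio of
    the normalising constants of the two Gaussians.\<close>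
  define D where "D = exp ((real k)\<^sup>2 / (4 * c)) * sqrt (2 * norm \<nu> / Re \<nu>) ^ CARD('n)"
  show thesis
  proof
    show "D > 0"
      using assms \<open>\<nu> \<noteq> 0\<close> by (simp add: D_def)
  next
    fix t :: real and x :: "real ^ 'n"
    assume "t > 0"
    define q where "q = sqrt (4 * pi * t * norm \<nu>) ^ CARD('n)"
    define \<sigma> where "\<sigma> = sqrt (4 * t * (norm \<nu>)\<^sup>2 / Re \<nu>)"
    define s where "s = norm x / sqrt t"
    have "q > 0"
      using \<open>t > 0\<close> \<open>\<nu> \<noteq> 0\<close> by (simp add: q_def)
    have \<sigma>2: "\<sigma>\<^sup>2 = 4 * t * (norm \<nu>)\<^sup>2 / Re \<nu>"
      using \<open>t > 0\<close> assms by (simp add: \<sigma>_def)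
    have s2: "s\<^sup>2 = (norm x)\<^sup>2 / t"
      using \<open>t > 0\<close> by (simp add: s_def power_divide)
    have "norm x ^ k = sqrt t ^ k * s ^ k"
      using \<open>t > 0\<close> by (simp add: s_def power_mult_distrib[symmetric])
    also have "sqrt t ^ k = t powr (real k / 2)"
      using \<open>t > 0\<close> by (simp add: powr_half_sqrt_powr powr_realpow real_sqrt_power)
    finally have xk: "norm x ^ k = t powr (real k / 2) * s ^ k" .
    have G: "norm (gauss_kernel (complex_of_real t * \<nu>) x) = exp (- 2 * c * s\<^sup>2) / q"
      using norm_gauss_kernel[OF \<open>t > 0\<close> assms, of x] by (simp add: q_def c_def s2)
    have "- (norm x)\<^sup>2 / (2 * \<sigma>\<^sup>2) = - c * s\<^sup>2"
      using \<open>t > 0\<close> assms \<open>\<nu> \<noteq> 0\<close> unfolding \<sigma>2 s2 c_def by (simp add: field_simps)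
    moreover have "sqrt (2 * pi * \<sigma>\<^sup>2) = sqrt (4 * pi * t * norm \<nu>) * sqrt (2 * norm \<nu> / Re \<nu>)"
      unfolding real_sqrt_mult[symmetric] \<sigma>2 by (simp add: field_simps power2_eq_square)
    ultimately have P: "gauss_density \<sigma> x = exp (- c * s\<^sup>2) / (q * sqrt (2 * norm \<nu> / Re \<nu>) ^ CARD('n))"
      unfolding gauss_density_eq by (simp add: q_def power_mult_distrib)
    have "norm (gauss_kernel (complex_of_real t * \<nu>) x) * norm x ^ k
        = t powr (real k / 2) / q * (s ^ k * exp (- 2 * c * s\<^sup>2))"
      unfolding G xk by simp
    also have "\<dots> \<le> t powr (real k / 2) / q * (exp ((real k)\<^sup>2 / (4 * c)) * exp (- c * s\<^sup>2))"
      using \<open>q > 0\<close> by (intro mult_left_mono power_mult_gauss_le \<open>c > 0\<close>) simp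
    also have "\<dots> = D * t powr (real k / 2) * gauss_density \<sigma> x"
      unfolding P D_def using assms \<open>\<nu> \<noteq> 0\<close> by simp
    finally show "norm (gauss_kernel (complex_of_real t * \<nu>) x) * norm x ^ k
        \<le> D * t powr (real k / 2) * gauss_density (sqrt (4 * t * (norm \<nu>)\<^sup>2 / Re \<nu>)) x"
      by (simp add: \<sigma>_def)
  qed
qed

section \<open>Convolution integrals\<close>

text \<open>Tonelli's theorem and translation invariance. Working in \<open>ennreal\<close> allows
  both sides to be infinite.\<close>

lemma nn_integral_convolution:
  fixes h f :: "'a::euclidean_space \<Rightarrow> ennreal"
  assumes h [measurable]: "h \<in> borel_measurable borel" and f: "f \<in> borel_measurable lebesgue"
  shows "(\<integral>\<^sup>+ x. \<integral>\<^sup>+ y. h (x - y) * f y \<partial>lebesgue \<partial>lebesgue) =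
    (\<integral>\<^sup>+ x. h x \<partial>lborel) * (\<integral>\<^sup>+ y. f y \<partial>lebesgue)"
proof -
  \<comment> \<open>Exchanging the integrals needs joint measurability for the product of Borel
    measures, so the Lebesgue measurable \<open>f\<close> is replaced by a Borel function equal to
    it almost everywhere.\<close>
  obtain g where g [measurable]: "g \<in> borel_measurable lborel" and fg: "AE y in lborel. f y = g y"
    using completion_ex_borel_measurable[OF f] by blast
  have "(\<integral>\<^sup>+ x. \<integral>\<^sup>+ y. h (x - y) * f y \<partial>lebesgue \<partial>lebesgue)
      = (\<integral>\<^sup>+ x. \<integral>\<^sup>+ y. h (x - y) * f y \<partial>lborel \<partial>lborel)"
    by (simp add: nn_integral_completion)
  also have "\<dots> = (\<integral>\<^sup>+ x. \<integral>\<^sup>+ y. h (x - y) * g y \<partial>lborel \<partial>lborel)"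
    using fg by (intro nn_integral_cong nn_integral_cong_AE) auto
  also have "\<dots> = (\<integral>\<^sup>+ y. \<integral>\<^sup>+ x. h (x - y) * g y \<partial>lborel \<partial>lborel)"
    by (intro lborel_pair.Fubini') measurable
  also have "\<dots> = (\<integral>\<^sup>+ y. (\<integral>\<^sup>+ x. h x \<partial>lborel) * g y \<partial>lborel)"
  proof (rule nn_integral_cong)
    fix y :: 'a
    have "(\<integral>\<^sup>+ x. h x \<partial>lborel) = (\<integral>\<^sup>+ x. h x \<partial>distr lborel borel ((+) (- y)))"
      by (simp add: lborel_distr_plus)
    also have "\<dots> = (\<integral>\<^sup>+ x. h (x - y) \<partial>lborel)"
      by (subst nn_integral_distr) auto
    finally show "(\<integral>\<^sup>+ x. h (x - y) * g y \<partial>lborel) = (\<integral>\<^sup>+ x. h x \<partial>lborel) * g y"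
      by (simp add: nn_integral_multc)
  qed
  also have "\<dots> = (\<integral>\<^sup>+ x. h x \<partial>lborel) * (\<integral>\<^sup>+ y. g y \<partial>lborel)"
    by (simp add: nn_integral_cmult)
  also have "(\<integral>\<^sup>+ y. g y \<partial>lborel) = (\<integral>\<^sup>+ y. f y \<partial>lebesgue)"
    using fg by (auto simp: nn_integral_completion intro: nn_integral_cong_AE)
  finally show ?thesis .
qed

lemma continuous_gauss_kernel:
  assumes "z \<noteq> 0"
  shows "continuous_on UNIV (gauss_kernel z :: real ^ 'n::finite \<Rightarrow> complex)"
  unfolding gauss_kernel_def using assms by (intro continuous_intros) auto

text \<open>The kernel is bounded by \<open>?K\<close>, its modulus at the origin, so a multiple of
  \<open>\<phi>\<close> dominates the product. Hence the Bochner integrals in \<open>heat_op\<close>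
  are genuine and linearity applies to them.\<close>

lemma integrable_gauss_kernel_mult:
  fixes \<phi> :: "real ^ 'n::finite \<Rightarrow> complex"
  assumes "t > 0" "Re \<nu> > 0" "integrable lebesgue \<phi>"
  shows "integrable lebesgue (\<lambda>y. gauss_kernel (complex_of_real t * \<nu>) (x - y) * \<phi> y)"
proof (rule Bochner_Integration.integrable_bound)
  let ?z = "complex_of_real t * \<nu>"
  let ?K = "1 / sqrt (4 * pi * t * norm \<nu>) ^ CARD('n)"
  show "integrable lebesgue (\<lambda>y. complex_of_real ?K * \<phi> y)"
    using assms by simp
  have "?z \<noteq> 0"
    using assms by auto
  have "continuous_on UNIV (\<lambda>y. gauss_kernel ?z (x - y))"
    by (intro continuous_on_compose2[OF continuous_gauss_kernel[OF \<open>?z \<noteq> 0\<close>]] continuous_intros) auto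
  then have "(\<lambda>y. gauss_kernel ?z (x - y)) \<in> borel_measurable borel"
    by (rule borel_measurable_continuous_onI)
  then have "(\<lambda>y. gauss_kernel ?z (x - y)) \<in> borel_measurable lebesgue"
    by (intro measurable_completion) simp
  then show "(\<lambda>y. gauss_kernel ?z (x - y) * \<phi> y) \<in> borel_measurable lebesgue"
    using assms(3) by (intro borel_measurable_times) auto
  have le: "norm (gauss_kernel ?z w) \<le> ?K" for w :: "real ^ 'n"
    unfolding norm_gauss_kernel[OF assms(1,2)] using assms
    by (intro divide_right_mono) auto
  show "AE y in lebesgue. norm (gauss_kernel ?z (x - y) * \<phi> y) \<le> norm (complex_of_real ?K * \<phi> y)"
  proof (rule AE_I2)
    fix y
    have "norm (gauss_kernel ?z (x - y)) * norm (\<phi> y) \<le> ?K * norm (\<phi> y)"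
      by (intro mult_right_mono le) simp
    also have "\<dots> = norm (complex_of_real ?K * \<phi> y)"
      using assms by (simp add: norm_mult norm_divide norm_power)
    finally show "norm (gauss_kernel ?z (x - y) * \<phi> y) \<le> norm (complex_of_real ?K * \<phi> y)"
      by (simp add: norm_mult)
  qed
qed

section \<open>Estimates of the commutator\<close>

text \<open>Both terms of the commutator are convergent integrals over \<open>y\<close>, so they
  merge into one with kernel \<open>G(x - y)\<close> times the difference of the monomials; the norm
  then passes inside.\<close>

lemma norm_heat_commutator_le:
  fixes \<phi> :: "real ^ 'n::finite \<Rightarrow> complex"
  assumes "t > 0" "Re \<nu> > 0" "integrable lebesgue \<phi>" "integrable lebesgue (mi_mult \<alpha> \<phi>)"
  shows "ennreal (norm (heat_commutator \<alpha> (complex_of_real t * \<nu>) \<phi> x)) \<le>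
    (\<integral>\<^sup>+ y. ennreal (norm (gauss_kernel (complex_of_real t * \<nu>) (x - y)) *
       \<bar>mi_power x \<alpha> - mi_power y \<alpha>\<bar> * norm (\<phi> y)) \<partial>lebesgue)"
proof -
  let ?G = "gauss_kernel (complex_of_real t * \<nu>) :: real ^ 'n \<Rightarrow> complex"
  let ?F = "\<lambda>y. complex_of_real (mi_power x \<alpha>) * (?G (x - y) * \<phi> y) - ?G (x - y) * mi_mult \<alpha> \<phi> y"
  note int = integrable_gauss_kernel_mult[OF assms(1,2)]
  have "integrable lebesgue ?F"
    using int[OF assms(3)] int[OF assms(4)] by simp
  moreover have "heat_commutator \<alpha> (complex_of_real t * \<nu>) \<phi> x = (\<integral>y. ?F y \<partial>lebesgue)"
    using int[OF assms(3)] int[OF assms(4)]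
    unfolding heat_commutator_def heat_op_def convol_def mi_mult_def by simp
  ultimately have "ennreal (norm (heat_commutator \<alpha> (complex_of_real t * \<nu>) \<phi> x))
      \<le> (\<integral>\<^sup>+ y. ennreal (norm (?F y)) \<partial>lebesgue)"
    by (simp add: integral_norm_bound_ennreal)
  moreover have "norm (?F y) = norm (?G (x - y)) * \<bar>mi_power x \<alpha> - mi_power y \<alpha>\<bar> * norm (\<phi> y)" for y
  proof -
    have "?F y = ?G (x - y) * complex_of_real (mi_power x \<alpha> - mi_power y \<alpha>) * \<phi> y"
      by (simp add: mi_mult_def algebra_simps)
    then show ?thesis
      by (simp only: norm_mult norm_of_real)
  qed
  ultimately show ?thesis
    by simp
qed

text \<open>The pointwise kernel bound has the form of a convolution of a probability density with a
  weighted \<open>norm (\<phi> y)\<close>, whose integral is explicit. The constant is fixed before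
  \<open>\<phi>\<close>, \<open>t\<close> and \<open>\<alpha>\<close>, so it serves every
  multi-index of order \<open>m\<close>.\<close>

lemma L1_norm_heat_commutator_le:
  fixes \<nu> :: complex and m :: nat
  assumes "Re \<nu> > 0" "m > 0"
  obtains K where "K > 0"
    "\<And>(\<phi> :: real ^ 'n::finite \<Rightarrow> complex) t \<alpha>. \<lbrakk>\<phi> \<in> weighted_L1 m; t > 0; mi_order \<alpha> = m\<rbrakk> \<Longrightarrow>
      L1_norm (heat_commutator \<alpha> (complex_of_real t * \<nu>) \<phi>) \<le> ennreal K *
        (ennreal (t powr (1 / 2)) * L1_norm (\<lambda>x. complex_of_real (norm x ^ (m - 1)) * \<phi> x)
         + ennreal (t powr (real m / 2)) * L1_norm \<phi>)"
proof -
  let ?\<sigma> = "\<lambda>t. sqrt (4 * t * (norm \<nu>)\<^sup>2 / Re \<nu>)"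
  \<comment> \<open>The moments 1 and \<open>m\<close> match the two terms of the monomial estimate.
    Both are bounded by the same density, so a single convolution suffices.\<close>
  obtain D1 where "D1 > 0" and D1:
    "\<And>t x. t > 0 \<Longrightarrow> norm (gauss_kernel (complex_of_real t * \<nu>) (x :: real ^ 'n)) * norm x ^ 1
       \<le> D1 * t powr (real 1 / 2) * gauss_density (?\<sigma> t) x"
    using gauss_kernel_moment_le[OF assms(1)] by blast
  obtain D2 where "D2 > 0" and D2:
    "\<And>t x. t > 0 \<Longrightarrow> norm (gauss_kernel (complex_of_real t * \<nu>) (x :: real ^ 'n)) * norm x ^ m
       \<le> D2 * t powr (real m / 2) * gauss_density (?\<sigma> t) x"
    using gauss_kernel_moment_le[OF assms(1)] by blast
  \<comment> \<open>The first factors come from the monomial estimate; \<open>D1 + D2\<close>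
    majorises both moment constants at once.\<close>
  define K where "K = real m * 2 ^ (m - 1) * (D1 + D2)"
  have "K > 0"
    using \<open>m > 0\<close> \<open>D1 > 0\<close> \<open>D2 > 0\<close> by (simp add: K_def)
  then show thesis
  proof
    fix \<phi> :: "real ^ 'n \<Rightarrow> complex" and t :: real and \<alpha> :: "'n \<Rightarrow> nat"
    assume \<phi>: "\<phi> \<in> weighted_L1 m" and "t > 0" and \<alpha>: "mi_order \<alpha> = m"
    let ?G = "gauss_kernel (complex_of_real t * \<nu>) :: real ^ 'n \<Rightarrow> complex"
    let ?P = "gauss_density (?\<sigma> t) :: real ^ 'n \<Rightarrow> real"
    define f where "f y = t powr (1 / 2) * (norm y ^ (m - 1) * norm (\<phi> y)) + t powr (real m / 2) * norm (\<phi> y)" for y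
    have int: "integrable lebesgue \<phi>" "integrable lebesgue (mi_mult \<alpha> \<phi>)"
      using \<phi> \<alpha> by (auto simp: weighted_L1_def)
    then have \<phi>_meas [measurable]: "\<phi> \<in> borel_measurable lebesgue"
      by auto
    have norm_meas [measurable]: "(\<lambda>y::real ^ 'n. norm y ^ (m - 1)) \<in> borel_measurable lebesgue"
      by (intro measurable_completion) simp
    have f_meas: "(\<lambda>y. ennreal (K * f y)) \<in> borel_measurable lebesgue"
      unfolding f_def by measurable
    have bound: "norm (?G (x - y)) * \<bar>mi_power x \<alpha> - mi_power y \<alpha>\<bar> * norm (\<phi> y) \<le> ?P (x - y) * (K * f y)"
      for x y
    proof -
      define w where "w = x - y"
      let ?g = "norm (?G w)" and ?M = "real m * 2 ^ (m - 1)" and ?Y = "norm y ^ (m - 1)"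
      have P: "0 \<le> ?P w"
        by (rule gauss_density_nonneg)
      have "?g * \<bar>mi_power x \<alpha> - mi_power y \<alpha>\<bar> \<le> ?g * (?M * (norm w * ?Y + norm w ^ m))"
        unfolding w_def by (intro mult_left_mono abs_mi_power_diff_le \<alpha> assms) simp
      also have "\<dots> = ?M * ((?g * norm w) * ?Y + ?g * norm w ^ m)"
        by (simp add: algebra_simps)
      also have "\<dots> \<le> ?M * ((D1 * t powr (1 / 2) * ?P w) * ?Y + D2 * t powr (real m / 2) * ?P w)"
        using D1[OF \<open>t > 0\<close>, of w] D2[OF \<open>t > 0\<close>, of w]
        by (intro mult_left_mono add_mono mult_right_mono) auto
      also have "\<dots> \<le> ?M * (((D1 + D2) * t powr (1 / 2) * ?P w) * ?Y + (D1 + D2) * t powr (real m / 2) * ?P w)"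
        using \<open>D1 > 0\<close> \<open>D2 > 0\<close> P by (intro mult_left_mono add_mono mult_right_mono) auto
      finally have "?g * \<bar>mi_power x \<alpha> - mi_power y \<alpha>\<bar> * norm (\<phi> y) \<le>
          ?M * (((D1 + D2) * t powr (1 / 2) * ?P w) * ?Y + (D1 + D2) * t powr (real m / 2) * ?P w) * norm (\<phi> y)"
        by (rule mult_right_mono) simp
      also have "\<dots> = ?P w * (K * f y)"
        by (simp add: K_def f_def algebra_simps)
      finally show ?thesis
        by (simp add: w_def)
    qed
    have "L1_norm (heat_commutator \<alpha> (complex_of_real t * \<nu>) \<phi>) \<le>
        (\<integral>\<^sup>+ x. \<integral>\<^sup>+ y. ennreal (norm (?G (x - y)) * \<bar>mi_power x \<alpha> - mi_power y \<alpha>\<bar> * norm (\<phi> y))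
           \<partial>lebesgue \<partial>lebesgue)"
      unfolding L1_norm_def
      by (intro nn_integral_mono norm_heat_commutator_le[OF \<open>t > 0\<close> assms(1) int])
    also have "\<dots> \<le> (\<integral>\<^sup>+ x. \<integral>\<^sup>+ y. ennreal (?P (x - y)) * ennreal (K * f y) \<partial>lebesgue \<partial>lebesgue)"
      using bound by (intro nn_integral_mono)
        (simp add: ennreal_mult'[symmetric] gauss_density_nonneg ennreal_leI)
    \<comment> \<open>The density has mass 1 for every \<open>t\<close>, so all dependence on
      \<open>t\<close> remains in the weights inside \<open>f\<close>.\<close>
    also have "\<dots> = (\<integral>\<^sup>+ x. ennreal (?P x) \<partial>lborel) * (\<integral>\<^sup>+ y. ennreal (K * f y) \<partial>lebesgue)"
      using f_meas by (intro nn_integral_convolution) auto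
    also have "(\<integral>\<^sup>+ x. ennreal (?P x) \<partial>lborel) = 1"
    proof (rule nn_integral_gauss_density)
      have "\<nu> \<noteq> 0"
        using assms(1) by auto
      then show "?\<sigma> t > 0"
        using \<open>t > 0\<close> assms(1) by simp
    qed
    also have "1 * (\<integral>\<^sup>+ y. ennreal (K * f y) \<partial>lebesgue) = (\<integral>\<^sup>+ y. ennreal (K * f y) \<partial>lebesgue)"
      by simp
    also have "\<dots> = (\<integral>\<^sup>+ y. ennreal K * (ennreal (t powr (1 / 2)) * ennreal (norm y ^ (m - 1) * norm (\<phi> y))
        + ennreal (t powr (real m / 2)) * ennreal (norm (\<phi> y))) \<partial>lebesgue)"
    proof (rule nn_integral_cong)
      fix y
      have "ennreal (K * f y) = ennreal K * ennreal (f y)"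
        using \<open>K > 0\<close> by (intro ennreal_mult') simp
      then show "ennreal (K * f y) = ennreal K * (ennreal (t powr (1 / 2)) * ennreal (norm y ^ (m - 1) * norm (\<phi> y))
          + ennreal (t powr (real m / 2)) * ennreal (norm (\<phi> y)))"
        by (simp only: f_def ennreal_plus ennreal_mult' powr_ge_zero norm_ge_zero zero_le_power mult_nonneg_nonneg)
    qed
    also have "\<dots> = ennreal K * (ennreal (t powr (1 / 2)) * (\<integral>\<^sup>+ y. ennreal (norm y ^ (m - 1) * norm (\<phi> y)) \<partial>lebesgue)
        + ennreal (t powr (real m / 2)) * (\<integral>\<^sup>+ y. ennreal (norm (\<phi> y)) \<partial>lebesgue))"
      by (subst nn_integral_cmult, measurable, subst nn_integral_add, measurable)
        (subst nn_integral_cmult, measurable)+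
    also have "\<dots> = ennreal K *
        (ennreal (t powr (1 / 2)) * L1_norm (\<lambda>x. complex_of_real (norm x ^ (m - 1)) * \<phi> x)
         + ennreal (t powr (real m / 2)) * L1_norm \<phi>)"
      by (simp add: L1_norm_def norm_mult norm_power)
    finally show "L1_norm (heat_commutator \<alpha> (complex_of_real t * \<nu>) \<phi>) \<le> ennreal K *
        (ennreal (t powr (1 / 2)) * L1_norm (\<lambda>x. complex_of_real (norm x ^ (m - 1)) * \<phi> x)
         + ennreal (t powr (real m / 2)) * L1_norm \<phi>)" .
  qed
qed

theorem theorem2p7:
  fixes \<nu> :: complex and m :: nat
  assumes "Re \<nu> > 0" and "m > 0"
  shows "\<exists>C::real. C > 0 \<and>
    (\<forall>\<phi> \<in> (weighted_L1 m :: (real ^ 'n::finite \<Rightarrow> complex) set). \<forall>t::real. t > 0 \<longrightarrow>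
      (\<Sum>\<alpha> | mi_order \<alpha> = m. L1_norm (heat_commutator \<alpha> (complex_of_real t * \<nu>) \<phi>))
      \<le> ennreal C *
        (ennreal (t powr (1 / 2)) * L1_norm (\<lambda>x. complex_of_real (norm x ^ (m - 1)) * \<phi> x)
         + ennreal (t powr (1 / 2) + t powr (real m / 2)) * L1_norm \<phi>))"
proof -
  obtain K where "K > 0" and K:
    "\<And>(\<phi> :: real ^ 'n \<Rightarrow> complex) t \<alpha>. \<lbrakk>\<phi> \<in> weighted_L1 m; t > 0; mi_order \<alpha> = m\<rbrakk> \<Longrightarrow>
      L1_norm (heat_commutator \<alpha> (complex_of_real t * \<nu>) \<phi>) \<le> ennreal K *
        (ennreal (t powr (1 / 2)) * L1_norm (\<lambda>x. complex_of_real (norm x ^ (m - 1)) * \<phi> x)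
         + ennreal (t powr (real m / 2)) * L1_norm \<phi>)"
    using L1_norm_heat_commutator_le[OF assms] by blast
  define N where "N = card {\<alpha> :: 'n \<Rightarrow> nat. mi_order \<alpha> = m}"
  \<comment> \<open>With \<open>Suc N\<close> in place of \<open>N\<close>, positivity of
    \<open>C\<close> follows without computing the number of multi-indices.\<close>
  define C where "C = real (Suc N) * K"
  show ?thesis
  proof (intro exI[of _ C] conjI ballI allI impI)
    show "C > 0"
      using \<open>K > 0\<close> by (simp add: C_def)
  next
    fix \<phi> :: "real ^ 'n \<Rightarrow> complex" and t :: real
    assume "\<phi> \<in> weighted_L1 m" "t > 0"
    let ?A = "ennreal (t powr (1 / 2)) * L1_norm (\<lambda>x. complex_of_real (norm x ^ (m - 1)) * \<phi> x)"
    let ?B = "?A + ennreal (t powr (real m / 2)) * L1_norm \<phi>"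
    let ?E = "?A + ennreal (t powr (1 / 2) + t powr (real m / 2)) * L1_norm \<phi>"
    have "(\<Sum>\<alpha> | mi_order \<alpha> = m. L1_norm (heat_commutator \<alpha> (complex_of_real t * \<nu>) \<phi>))
        \<le> of_nat N * (ennreal K * ?B)"
      unfolding N_def using K \<open>\<phi> \<in> weighted_L1 m\<close> \<open>t > 0\<close> by (intro sum_bounded_above) auto
    also have "\<dots> = ennreal (real N * K) * ?B"
      using \<open>K > 0\<close> by (simp add: ennreal_mult' ennreal_of_nat_eq_real_of_nat mult.assoc)
    \<comment> \<open>Monotonicity in each place: \<open>N * K \<le> C\<close>, and
      \<open>t powr (m / 2)\<close> only grows when \<open>t powr (1 / 2)\<close> is added.\<close>
    also have "\<dots> \<le> ennreal C * ?E"
      using \<open>K > 0\<close> by (intro mult_mono add_mono ennreal_leI) (auto simp: C_def)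
    finally show "(\<Sum>\<alpha> | mi_order \<alpha> = m. L1_norm (heat_commutator \<alpha> (complex_of_real t * \<nu>) \<phi>))
        \<le> ennreal C * ?E" .
  qed
qed

end
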